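(* Let $\mathsf{M}$ be a matroid on $[n]$ ($n\ge1$) and let $f\in\mathrm{PLaur}(\Sigma_n)$ be a piecewise Laurent polynomial. Let $\omega_{\mathsf{M}}\in\mathrm{PLaur}(\Sigma_n)$ be given by $$(\omega_{\mathsf{M}})_\sigma=\frac{x_{\sigma(n)}}{x_{\sigma(1)}}\prod_{i\in[n]\setminus B_{\mathsf{M}}(\sigma)}x_i^{-1}\qquad(\sigma\in S_n).$$ Then $$Q_{\mathsf{M}}(f^\vee)=(-1)^{\mathrm{rk}(\mathsf{M})-1}\,Q_{\mathsf{M}}(f\cdot\omega_{\mathsf{M}})^\vee.$$
   Context: $[n]=\{1,\dots,n\}$; $S_n$ is the set of permutations of $[n]$; $\tau_i\in S_n$ is the adjacent transposition swapping $i$ and $i+1$. A piecewise Laurent polynomial on the braid fan $\Sigma_n$ is a collection $f=\{f_\sigma:\sigma\in S_n\}$ of Laurent polynomials $f_\sigma\in\mathbb{Z}[x_1^{\pm1},\dots,x_n^{\pm1}]$ such that for every $\sigma\in S_n$ and $i\in[n-1]$, $f_\sigma-f_{\sigma\circ\tau_i}$ is divisible in $\mathbb{Z}[x_1^{\pm1},\dots,x_n^{\pm1}]$ by $x_{\sigma(i)}-x_{\sigma(i+1)}$. The ring of these (componentwise operations) is $\mathrm{PLaur}(\Sigma_n)$. For a matroid $\mathsf{M}$ on $[n]$ with rank function $\mathrm{rk}_{\mathsf{M}}$ (and $\mathrm{rk}(\mathsf{M})=\mathrm{rk}_{\mathsf{M}}([n])$), the greedy basis determined by $\sigma\in S_n$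 is $$B_{\mathsf{M}}(\sigma)=\{\sigma(i): \mathrm{rk}_{\mathsf{M}}\{\sigma(1),\dots,\sigma(i)\}>\mathrm{rk}_{\mathsf{M}}\{\sigma(1),\dots,\sigma(i-1)\}\}.$$ For $f\in\mathrm{PLaur}(\Sigma_n)$, $$Q_{\mathsf{M}}(f)=\sum_{\sigma\in S_n} f_\sigma\, Q(C_\sigma)\prod_{i\in[n]\setminus B_{\mathsf{M}}(\sigma)}(1-x_i),\qquad Q(C_\sigma)=\frac{1}{\prod_{i=1}^{n-1}\left(1-\frac{x_{\sigma(i+1)}}{x_{\sigma(i)}}\right)};$$ this is a Laurent polynomial in $\mathbb{Z}[x_1^{\pm1},\dots,x_n^{\pm1}]$. $(-)^\vee$ denotes the operation inverting all variables, $x_i\mapsto x_i^{-1}$, both on Laurent polynomials and componentwise on $\mathrm{PLaur}(\Sigma_n)$. *)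

theory Defs
  imports
    "HOL-Library.Poly_Mapping"
    "HOL-Computational_Algebra.Polynomial_Factorial"
    "HOL-Combinatorics.Permutations"
begin

section \<open>Laurent polynomials\<close>

text \<open>
  An element of the following type is a finitely supported integer-valued function on finitely
  supported integer exponent vectors, with convolution as product: it is the ring of Laurent
  polynomials over the integers in the variables \<open>x\<^sub>i\<close> for all natural numbers \<open>i\<close>.
  The ring in \<open>x\<^sub>1, \<dots>, x\<^sub>n\<close> is its subring \<open>laurent_polys n\<close>.
\<close>
type_synonym laurent = "(nat \<Rightarrow>\<^sub>0 int) \<Rightarrow>\<^sub>0 int"

definition laurent_polys :: "nat \<Rightarrow> laurent set" where
  "laurent_polys n = {p. \<forall>m \<in> Poly_Mapping.keys p. Poly_Mapping.keys m \<subseteq> {1..n}}"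

definition X :: "nat \<Rightarrow> laurent" where
  "X i = Poly_Mapping.single (Poly_Mapping.single i 1) 1"

definition Xinv :: "nat \<Rightarrow> laurent" where
  "Xinv i = Poly_Mapping.single (Poly_Mapping.single i (- 1)) 1"

text \<open>
  The involution \<open>x\<^sub>i \<mapsto> x\<^sub>i\<inverse>\<close>: the coefficient of \<open>p\<close> at the exponent vector \<open>m\<close> becomes
  the coefficient of \<open>invert_vars p\<close> at \<open>- m\<close>.
\<close>
definition invert_vars :: "laurent \<Rightarrow> laurent" where
  "invert_vars p = Poly_Mapping.map_key uminus p"

lemma lookup_invert_vars:
  "Poly_Mapping.lookup (invert_vars p) m = Poly_Mapping.lookup p (- m)"
  by (simp add: invert_vars_def map_key.rep_eq)

section \<open>Piecewise Laurent polynomials on the braid fan\<close>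

text \<open>
  A family indexed by the permutations of \<open>{1..n}\<close> is a function on \<open>nat \<Rightarrow> nat\<close>, of which only
  the values at such permutations matter.
\<close>
definition PLaur :: "nat \<Rightarrow> ((nat \<Rightarrow> nat) \<Rightarrow> laurent) set" where
  "PLaur n = {f.
     (\<forall>\<sigma>. \<sigma> permutes {1..n} \<longrightarrow> f \<sigma> \<in> laurent_polys n) \<and>
     (\<forall>\<sigma>. \<sigma> permutes {1..n} \<longrightarrow> (\<forall>i \<in> {1..n-1}.
        \<exists>q \<in> laurent_polys n.
          f \<sigma> - f (\<sigma> \<circ> transpose i (i + 1)) = (X (\<sigma> i) - X (\<sigma> (i + 1))) * q))}"

section \<open>Matroids\<close>

definition is_matroid :: "'a set \<Rightarrow> 'a set set \<Rightarrow> bool" where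
  "is_matroid E \<I> \<longleftrightarrow>
     finite E \<and>
     (\<forall>I \<in> \<I>. I \<subseteq> E) \<and>
     {} \<in> \<I> \<and>
     (\<forall>I J. J \<in> \<I> \<and> I \<subseteq> J \<longrightarrow> I \<in> \<I>) \<and>
     (\<forall>I \<in> \<I>. \<forall>J \<in> \<I>. card I < card J \<longrightarrow> (\<exists>e \<in> J - I. insert e I \<in> \<I>))"

definition matroid_rank :: "'a set set \<Rightarrow> 'a set \<Rightarrow> nat" where
  "matroid_rank \<I> S = Max {card I | I. I \<in> \<I> \<and> I \<subseteq> S}"

definition greedy_basis :: "nat \<Rightarrow> nat set set \<Rightarrow> (nat \<Rightarrow> nat) \<Rightarrow> nat set" where
  "greedy_basis n \<I> \<sigma> =
     {\<sigma> i | i. i \<in> {1..n} \<and> matroid_rank \<I> (\<sigma> ` {1..i}) > matroid_rank \<I> (\<sigma> ` {1..i-1})}"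

section \<open>The functional \<open>Q\<close>\<close>

definition Q_cone :: "nat \<Rightarrow> (nat \<Rightarrow> nat) \<Rightarrow> laurent fract" where
  "Q_cone n \<sigma> = 1 / (\<Prod>i = 1..n-1. 1 - to_fract (X (\<sigma> (i + 1))) / to_fract (X (\<sigma> i)))"

definition Q_frac :: "nat \<Rightarrow> nat set set \<Rightarrow> ((nat \<Rightarrow> nat) \<Rightarrow> laurent) \<Rightarrow> laurent fract" where
  "Q_frac n \<I> f =
     (\<Sum>\<sigma> | \<sigma> permutes {1..n}.
        to_fract (f \<sigma>) * Q_cone n \<sigma> *
        (\<Prod>i \<in> {1..n} - greedy_basis n \<I> \<sigma>. 1 - to_fract (X i)))"

text \<open>
  For a matroid on \<open>{1..n}\<close> and \<open>f \<in> PLaur n\<close> the sum \<open>Q_frac n \<I> f\<close>, a priori a rational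
  function, is a Laurent polynomial; \<open>Q_matroid n \<I> f\<close> is that Laurent polynomial. It is unique,
  since \<open>to_fract\<close> is injective.
\<close>
definition Q_matroid :: "nat \<Rightarrow> nat set set \<Rightarrow> ((nat \<Rightarrow> nat) \<Rightarrow> laurent) \<Rightarrow> laurent" where
  "Q_matroid n \<I> f = (THE q. q \<in> laurent_polys n \<and> to_fract q = Q_frac n \<I> f)"

definition omega :: "nat \<Rightarrow> nat set set \<Rightarrow> (nat \<Rightarrow> nat) \<Rightarrow> laurent" where
  "omega n \<I> \<sigma> =
     X (\<sigma> n) * Xinv (\<sigma> 1) * (\<Prod>i \<in> {1..n} - greedy_basis n \<I> \<sigma>. Xinv i)"

text \<open>
  The power \<open>(-1)\<^sup>k\<close> for an integer \<open>k\<close>. The exponent \<open>rk M - 1\<close> is negative for a matroid of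
  rank 0, where truncated subtraction would give the wrong sign.
\<close>
definition neg_one_pow :: "int \<Rightarrow> laurent" where
  "neg_one_pow k = (if even k then 1 else - 1)"

end

theory Submission
  imports Defs
begin

text \<open>
  Write \<open>u\<^sub>i = x\<^bsub>\<sigma>(i+1)\<^esub> / x\<^bsub>\<sigma>(i)\<^esub>\<close>. Inverting the variables turns each factor \<open>1 / (1 - u\<^sub>i)\<close>
  of the cone term into \<open>- u\<^sub>i / (1 - u\<^sub>i)\<close>, and the product of the \<open>u\<^sub>i\<close> telescopes; it turns
  each \<open>1 - x\<^sub>i\<close> into \<open>- x\<^sub>i\<inverse> (1 - x\<^sub>i)\<close>. The monomials so produced are exactly those of
  \<open>\<omega>\<close>, and the \<open>n - 1 + (n - rk M)\<close> signs do not depend on \<open>\<sigma>\<close>, so the identity holds term by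
  term. What remains is that the sums are Laurent polynomials. A common denominator is a product of
  differences \<open>x\<^sub>a - x\<^sub>b\<close>, and a Laurent polynomial is divisible by \<open>x\<^sub>a - x\<^sub>b\<close> iff it vanishes under
  \<open>x\<^sub>a \<mapsto> x\<^sub>b\<close>. Along \<open>x\<^sub>a = x\<^sub>b\<close> only the terms in which \<open>a\<close> and \<open>b\<close> are adjacent have a pole, and
  it cancels in the sum of the terms of \<open>\<sigma>\<close> and \<open>(a b) \<circ> \<sigma>\<close>, because the greedy basis of
  \<open>(a b) \<circ> \<sigma>\<close> is either that of \<open>\<sigma>\<close> or its image under \<open>(a b)\<close>.
\<close>

section \<open>Substitutions in Laurent polynomials\<close>

text \<open>A Laurent polynomial is an element of the free abelian group on exponent vectors, and
  this is the homomorphism induced by a map of basis elements, so additivity comes from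
  \<open>frag_extend\<close>. Identifying two variables and inverting all of them are both
  instances.\<close>

definition map_exps :: "('a \<Rightarrow> 'b) \<Rightarrow> ('a \<Rightarrow>\<^sub>0 int) \<Rightarrow> ('b \<Rightarrow>\<^sub>0 int)" where
  "map_exps g = frag_extend (frag_of \<circ> g)"

lemma map_exps_of [simp]: "map_exps g (frag_of a) = frag_of (g a)"
  by (simp add: map_exps_def)

lemma map_exps_0 [simp]: "map_exps g 0 = 0"
  by (simp add: map_exps_def)

lemma map_exps_diff: "map_exps g (p - q) = map_exps g p - map_exps g q"
  by (simp add: map_exps_def frag_extend_diff)

lemma map_exps_add: "map_exps g (p + q) = map_exps g p + map_exps g q"
  by (simp add: map_exps_def frag_extend_add)

text \<open>Both sides are additive in \<open>p\<close> and in \<open>q\<close>, so monomials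
  suffice, and there the claim is the additivity of \<open>g\<close>.\<close>

lemma map_exps_mult:
  fixes g :: "'a::comm_monoid_add \<Rightarrow> 'b::comm_monoid_add"
  assumes "\<And>x y. g (x + y) = g x + g y"
  shows "map_exps g (p * q) = map_exps g p * map_exps g q"
proof -
  have *: "map_exps g (frag_of a * q) = frag_of (g a) * map_exps g q" for a
  proof (rule frag_induction[of q UNIV])
    show "map_exps g (frag_of a * frag_of b) = frag_of (g a) * map_exps g (frag_of b)" for b
      by (simp add: mult_single assms)
  qed (simp_all add: right_diff_distrib map_exps_diff)
  show ?thesis
    by (rule frag_induction[of p UNIV]) (simp_all add: * left_diff_distrib map_exps_diff)
qed

lemma map_exps_1:
  fixes g :: "'a::zero \<Rightarrow> 'b::zero"
  assumes "g 0 = 0"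
  shows "map_exps g 1 = 1"
  by (simp add: single_one[symmetric] assms del: single_one)

section \<open>The subring of Laurent polynomials in x_1, ..., x_n\<close>

lemma laurent_polys_0 [simp]: "0 \<in> laurent_polys n"
  by (simp add: laurent_polys_def)

lemma laurent_polys_single [simp]:
  "Poly_Mapping.keys m \<subseteq> {1..n} \<Longrightarrow> Poly_Mapping.single m c \<in> laurent_polys n"
  by (auto simp: laurent_polys_def)

lemma laurent_polys_diff: "p \<in> laurent_polys n \<Longrightarrow> q \<in> laurent_polys n \<Longrightarrow> p - q \<in> laurent_polys n"
  using keys_diff[of p q] by (fastforce simp: laurent_polys_def)

lemma laurent_polys_add: "p \<in> laurent_polys n \<Longrightarrow> q \<in> laurent_polys n \<Longrightarrow> p + q \<in> laurent_polys n"
  using keys_add[of p q] by (fastforce simp: laurent_polys_def)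

lemma laurent_polys_uminus: "p \<in> laurent_polys n \<Longrightarrow> - p \<in> laurent_polys n"
  by (simp add: laurent_polys_def)

lemma laurent_polys_1 [simp]: "1 \<in> laurent_polys n"
  by (simp add: single_one[symmetric] del: single_one)

lemma laurent_polys_mult:
  assumes "p \<in> laurent_polys n" "q \<in> laurent_polys n"
  shows "p * q \<in> laurent_polys n"
proof -
  have "Poly_Mapping.keys m \<subseteq> {1..n}" if m: "m \<in> Poly_Mapping.keys (p * q)" for m
  proof -
    from m keys_mult[of p q] obtain a b where
      "m = a + b" "a \<in> Poly_Mapping.keys p" "b \<in> Poly_Mapping.keys q" by blast
    then show ?thesis
      using assms keys_add[of a b] by (fastforce simp: laurent_polys_def)
  qed
  then show ?thesis by (auto simp: laurent_polys_def)
qed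

lemma laurent_polys_prod:
  "(\<And>i. i \<in> A \<Longrightarrow> p i \<in> laurent_polys n) \<Longrightarrow> (\<Prod>i\<in>A. p i) \<in> laurent_polys n"
  by (induction A rule: infinite_finite_induct) (auto intro: laurent_polys_mult)

lemma laurent_polys_sum:
  "(\<And>i. i \<in> A \<Longrightarrow> p i \<in> laurent_polys n) \<Longrightarrow> (\<Sum>i\<in>A. p i) \<in> laurent_polys n"
  by (induction A rule: infinite_finite_induct) (auto intro: laurent_polys_add)

lemma laurent_polys_X [simp]: "i \<in> {1..n} \<Longrightarrow> X i \<in> laurent_polys n"
  by (simp add: X_def)

lemma laurent_polys_Xinv [simp]: "i \<in> {1..n} \<Longrightarrow> Xinv i \<in> laurent_polys n"
  by (simp add: Xinv_def)

lemma X_nonzero [simp]: "X i \<noteq> 0"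
  by (simp add: X_def)

lemma X_eq_iff [simp]: "X i = X j \<longleftrightarrow> i = j"
proof -
  have "Poly_Mapping.keys (Poly_Mapping.single i (1::int)) = {i}" for i :: nat by simp
  then show ?thesis unfolding X_def frag_of_eq by (metis singleton_inject)
qed

lemma X_Xinv: "X i * Xinv i = 1"
  by (simp add: X_def Xinv_def mult_single flip: single_add)

text \<open>The effect of \<open>x\<^sub>a \<mapsto> x\<^sub>b\<close> on exponent vectors.\<close>
definition subst_exp :: "nat \<Rightarrow> nat \<Rightarrow> (nat \<Rightarrow>\<^sub>0 int) \<Rightarrow> (nat \<Rightarrow>\<^sub>0 int)" where
  "subst_exp a b m = m - Poly_Mapping.single a (Poly_Mapping.lookup m a)
     + Poly_Mapping.single b (Poly_Mapping.lookup m a)"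

abbreviation subst_var :: "nat \<Rightarrow> nat \<Rightarrow> laurent \<Rightarrow> laurent" where
  "subst_var a b \<equiv> map_exps (subst_exp a b)"

lemma subst_exp_add: "subst_exp a b (x + y) = subst_exp a b x + subst_exp a b y"
  by (simp add: subst_exp_def lookup_add single_add)

lemma subst_exp_0 [simp]: "subst_exp a b 0 = 0"
  by (simp add: subst_exp_def)

lemma subst_var_mult: "subst_var a b (p * q) = subst_var a b p * subst_var a b q"
  by (rule map_exps_mult) (rule subst_exp_add)

lemma subst_var_1 [simp]: "subst_var a b 1 = 1"
  by (rule map_exps_1) simp

lemma subst_var_prod: "subst_var a b (\<Prod>i\<in>A. p i) = (\<Prod>i\<in>A. subst_var a b (p i))"
  by (induction A rule: infinite_finite_induct) (simp_all add: subst_var_mult)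

lemma subst_var_X: "subst_var a b (X c) = X (if c = a then b else c)"
  by (simp add: X_def subst_exp_def lookup_single)

lemma subst_var_Xinv: "subst_var a b (Xinv c) = Xinv (if c = a then b else c)"
  by (simp add: Xinv_def subst_exp_def lookup_single)

text \<open>Induction on the integer \<open>k\<close> in both directions from 0. The quotient is
  built explicitly, which keeps it inside the subring.\<close>

lemma X_diff_dvd_power_diff:
  assumes "a \<in> {1..n}" "b \<in> {1..n}"
  shows "\<exists>q \<in> laurent_polys n.
    frag_of (Poly_Mapping.single a k) - frag_of (Poly_Mapping.single b k) = (X a - X b) * q"
proof (induction k rule: int_induct[where k = 0])
  case base
  show ?case by (rule bexI[of _ 0]) auto
next
  case (step1 i)
  then obtain q where q: "q \<in> laurent_polys n"
    "frag_of (Poly_Mapping.single a i) - frag_of (Poly_Mapping.single b i) = (X a - X b) * q" by blast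
  have "frag_of (Poly_Mapping.single c (i + 1)) = frag_of (Poly_Mapping.single c i) * X c" for c :: nat
    by (simp add: X_def mult_single single_add)
  then have "frag_of (Poly_Mapping.single a (i + 1)) - frag_of (Poly_Mapping.single b (i + 1))
    = frag_of (Poly_Mapping.single a i) * (X a - X b)
      + (frag_of (Poly_Mapping.single a i) - frag_of (Poly_Mapping.single b i)) * X b"
    by (simp add: algebra_simps)
  also have "\<dots> = (X a - X b) * (frag_of (Poly_Mapping.single a i) + q * X b)"
    by (simp add: q algebra_simps)
  finally show ?case
    using assms q(1) by (intro bexI[of _ "frag_of (Poly_Mapping.single a i) + q * X b"])
      (auto intro!: laurent_polys_add laurent_polys_mult)
next
  case (step2 i)
  then obtain q where q: "q \<in> laurent_polys n"
    "frag_of (Poly_Mapping.single a i) - frag_of (Poly_Mapping.single b i) = (X a - X b) * q" by blast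
  have "frag_of (Poly_Mapping.single c (i - 1)) = frag_of (Poly_Mapping.single c i) * Xinv c" for c :: nat
    by (simp add: Xinv_def mult_single flip: single_add)
  \<comment> \<open>The factors \<open>X b * Xinv b\<close> and \<open>X a * Xinv a\<close> are 1;
    they expose x_b - x_a in the difference of the inverses.\<close>
  then have "frag_of (Poly_Mapping.single a (i - 1)) - frag_of (Poly_Mapping.single b (i - 1))
    = frag_of (Poly_Mapping.single b i) * (Xinv a * (X b * Xinv b) - Xinv b * (X a * Xinv a))
      + (frag_of (Poly_Mapping.single a i) - frag_of (Poly_Mapping.single b i)) * Xinv a"
    by (simp add: algebra_simps X_Xinv)
  also have "\<dots> = (X a - X b) * (q * Xinv a - frag_of (Poly_Mapping.single b i) * Xinv a * Xinv b)"
    by (simp add: q algebra_simps)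
  finally show ?case
    using assms q(1)
    by (intro bexI[of _ "q * Xinv a - frag_of (Poly_Mapping.single b i) * Xinv a * Xinv b"])
      (auto intro!: laurent_polys_diff laurent_polys_mult)
qed

text \<open>Additivity reduces this to a monomial x^r x_a^k with x_a absent from x^r, where the
  difference is x^r (x_a^k - x_b^k).\<close>

lemma subst_var_diff_dvd:
  assumes "a \<in> {1..n}" "b \<in> {1..n}" "p \<in> laurent_polys n"
  shows "\<exists>q \<in> laurent_polys n. p - subst_var a b p = (X a - X b) * q"
proof (rule frag_induction[of p "{m. Poly_Mapping.keys m \<subseteq> {1..n}}"])
  show "Poly_Mapping.keys p \<subseteq> {m. Poly_Mapping.keys m \<subseteq> {1..n}}"
    using assms(3) by (auto simp: laurent_polys_def)
  show "\<exists>q \<in> laurent_polys n. 0 - subst_var a b 0 = (X a - X b) * q"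
    by (rule bexI[of _ 0]) auto
next
  fix m :: "nat \<Rightarrow>\<^sub>0 int" assume m: "m \<in> {m. Poly_Mapping.keys m \<subseteq> {1..n}}"
  define k where "k = Poly_Mapping.lookup m a"
  define r where "r = m - Poly_Mapping.single a k"
  obtain q where q: "q \<in> laurent_polys n"
    "frag_of (Poly_Mapping.single a k) - frag_of (Poly_Mapping.single b k) = (X a - X b) * q"
    using X_diff_dvd_power_diff[OF assms(1,2)] by blast
  have "Poly_Mapping.keys r \<subseteq> {1..n}"
    using m assms(1) keys_diff[of m "Poly_Mapping.single a k"] by (fastforce simp: r_def split: if_splits)
  moreover have "frag_of m - subst_var a b (frag_of m) =
      frag_of r * (frag_of (Poly_Mapping.single a k) - frag_of (Poly_Mapping.single b k))"
    by (simp add: right_diff_distrib mult_single r_def k_def subst_exp_def)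
  ultimately show "\<exists>q \<in> laurent_polys n. frag_of m - subst_var a b (frag_of m) = (X a - X b) * q"
    using q by (intro bexI[of _ "frag_of r * q"]) (auto intro!: laurent_polys_mult simp: algebra_simps)
next
  fix p p' :: laurent
  assume "\<exists>q \<in> laurent_polys n. p - subst_var a b p = (X a - X b) * q"
    "\<exists>q \<in> laurent_polys n. p' - subst_var a b p' = (X a - X b) * q"
  then obtain q q' where "q \<in> laurent_polys n" "p - subst_var a b p = (X a - X b) * q"
    "q' \<in> laurent_polys n" "p' - subst_var a b p' = (X a - X b) * q'" by blast
  moreover have "p - p' - subst_var a b (p - p') = (p - subst_var a b p) - (p' - subst_var a b p')"
    by (simp add: map_exps_diff)
  ultimately show "\<exists>q \<in> laurent_polys n. p - p' - subst_var a b (p - p') = (X a - X b) * q"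
    by (metis laurent_polys_diff right_diff_distrib)
qed

text \<open>The substitution sends x_a - x_b to 0; conversely, if it kills \<open>p\<close>, then
  \<open>p\<close> itself is the difference in \<open>subst_var_diff_dvd\<close>. Divisibility
  inside the subring thus becomes a vanishing test.\<close>

lemma X_diff_dvd_iff:
  assumes "a \<in> {1..n}" "b \<in> {1..n}" "p \<in> laurent_polys n"
  shows "(\<exists>q \<in> laurent_polys n. p = (X a - X b) * q) \<longleftrightarrow> subst_var a b p = 0"
  using subst_var_diff_dvd[OF assms]
  by (auto simp: subst_var_mult map_exps_diff subst_var_X)

section \<open>Inversion of the variables as a ring homomorphism\<close>

lemma invert_vars_eq_map_exps: "invert_vars = map_exps uminus"
proof
  fix p
  show "invert_vars p = map_exps uminus p"
  proof (rule frag_induction[of p UNIV])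
    \<comment> \<open>\<open>map_key\<close> pulls coefficients back along negation and
      \<open>map_exps\<close> pushes them forward; these agree because negation is its own
      inverse.\<close>
    show "invert_vars (frag_of m) = map_exps uminus (frag_of m)" for m
      by (rule poly_mapping_eqI) (simp add: lookup_invert_vars lookup_single when_def, metis minus_minus)
    show "invert_vars 0 = map_exps uminus 0"
      by (rule poly_mapping_eqI) (simp add: lookup_invert_vars)
    fix p q assume "invert_vars p = map_exps uminus p" "invert_vars q = map_exps uminus q"
    moreover have "invert_vars (p - q) = invert_vars p - invert_vars q"
      by (rule poly_mapping_eqI) (simp add: lookup_invert_vars lookup_minus)
    ultimately show "invert_vars (p - q) = map_exps uminus (p - q)"
      by (simp add: map_exps_diff)
  qed simp
qed

lemma invert_vars_0 [simp]: "invert_vars 0 = 0"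
  by (simp add: invert_vars_eq_map_exps)

lemma invert_vars_1 [simp]: "invert_vars 1 = 1"
  by (simp add: invert_vars_eq_map_exps map_exps_1)

lemma invert_vars_add: "invert_vars (p + q) = invert_vars p + invert_vars q"
  by (simp add: invert_vars_eq_map_exps map_exps_add)

lemma invert_vars_diff: "invert_vars (p - q) = invert_vars p - invert_vars q"
  by (simp add: invert_vars_eq_map_exps map_exps_diff)

lemma invert_vars_mult: "invert_vars (p * q) = invert_vars p * invert_vars q"
  by (simp add: invert_vars_eq_map_exps map_exps_mult)

lemma invert_vars_prod: "invert_vars (\<Prod>i\<in>A. p i) = (\<Prod>i\<in>A. invert_vars (p i))"
  by (induction A rule: infinite_finite_induct) (simp_all add: invert_vars_mult)

lemma invert_vars_invert_vars [simp]: "invert_vars (invert_vars p) = p"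
  by (rule poly_mapping_eqI) (simp add: lookup_invert_vars)

lemma invert_vars_eq_0_iff [simp]: "invert_vars p = 0 \<longleftrightarrow> p = 0"
  by (metis invert_vars_0 invert_vars_invert_vars)

lemma invert_vars_X [simp]: "invert_vars (X i) = Xinv i"
  by (simp add: invert_vars_eq_map_exps X_def Xinv_def single_uminus)

lemma invert_vars_Xinv [simp]: "invert_vars (Xinv i) = X i"
  using invert_vars_X invert_vars_invert_vars by metis

lemma invert_vars_laurent_polys: "p \<in> laurent_polys n \<Longrightarrow> invert_vars p \<in> laurent_polys n"
  unfolding laurent_polys_def
  by (auto simp: in_keys_iff lookup_invert_vars) (metis atLeastAtMost_iff in_keys_iff keys_minus subsetD)+

section \<open>Greedy bases and adjacent transpositions\<close>

context
  fixes E :: "'a set" and \<I> :: "'a set set"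
  assumes matroid: "is_matroid E \<I>"
begin

private lemma finite_cards: "finite {card I | I. I \<in> \<I> \<and> I \<subseteq> S}"
proof -
  have "\<I> \<subseteq> Pow E" "finite E" using matroid by (auto simp: is_matroid_def)
  then have "finite \<I>" by (meson finite_Pow_iff finite_subset)
  then show ?thesis by simp
qed

private lemma rank_witness:
  obtains I where "I \<in> \<I>" "I \<subseteq> S" "matroid_rank \<I> S = card I"
proof -
  have "{card I | I. I \<in> \<I> \<and> I \<subseteq> S} \<noteq> {}"
    using matroid by (auto simp: is_matroid_def)
  then have "matroid_rank \<I> S \<in> {card I | I. I \<in> \<I> \<and> I \<subseteq> S}"
    unfolding matroid_rank_def by (rule Max_in[OF finite_cards])
  then show ?thesis using that by blast
qed

private lemma card_le_rank: "I \<in> \<I> \<Longrightarrow> I \<subseteq> S \<Longrightarrow> card I \<le> matroid_rank \<I> S"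
  unfolding matroid_rank_def by (rule Max_ge[OF finite_cards]) blast

lemma matroid_rank_empty: "matroid_rank \<I> {} = 0"
  by (rule rank_witness[of "{}"]) simp

lemma matroid_rank_mono: "S \<subseteq> T \<Longrightarrow> matroid_rank \<I> S \<le> matroid_rank \<I> T"
proof -
  assume "S \<subseteq> T"
  obtain I where "I \<in> \<I>" "I \<subseteq> S" "matroid_rank \<I> S = card I" by (rule rank_witness)
  with \<open>S \<subseteq> T\<close> show ?thesis using card_le_rank[of I T] by simp
qed

lemma matroid_rank_insert_le: "matroid_rank \<I> (insert e S) \<le> Suc (matroid_rank \<I> S)"
proof -
  obtain I where I: "I \<in> \<I>" "I \<subseteq> insert e S" "matroid_rank \<I> (insert e S) = card I"
    by (rule rank_witness)
  then have "I - {e} \<in> \<I>" "I - {e} \<subseteq> S" using matroid unfolding is_matroid_def by blast+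
  then have "card (I - {e}) \<le> matroid_rank \<I> S" by (rule card_le_rank)
  then show ?thesis
    using I(3) card_Diff_singleton[of e I] by (cases "e \<in> I") auto
qed

end

lemma image_atLeast1_Suc:
  fixes \<sigma> :: "nat \<Rightarrow> 'a"
  shows "\<sigma> ` {1..Suc k} = insert (\<sigma> (Suc k)) (\<sigma> ` {1..k})"
  by (simp add: atLeastAtMostSuc_conv)

lemma greedy_basis_mem_iff:
  assumes "\<sigma> permutes {1..n}" "i \<in> {1..n}"
  shows "\<sigma> i \<in> greedy_basis n \<I> \<sigma> \<longleftrightarrow>
    matroid_rank \<I> (\<sigma> ` {1..i-1}) < matroid_rank \<I> (\<sigma> ` {1..i})"
  unfolding greedy_basis_def mem_Collect_eq inj_eq[OF permutes_inj[OF assms(1)]]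
  using assms(2) by blast

lemma greedy_basis_subset: "\<sigma> permutes {1..n} \<Longrightarrow> greedy_basis n \<I> \<sigma> \<subseteq> {1..n}"
  by (auto simp: greedy_basis_def permutes_in_image simp del: atLeastAtMost_iff)

lemma card_filter_Suc:
  "card {i \<in> {1..Suc k}. P i} = card {i \<in> {1..k}. P i} + (if P (Suc k) then 1 else 0)"
proof -
  have "{i \<in> {1..Suc k}. P i} = {i \<in> {1..k}. P i} \<union> (if P (Suc k) then {Suc k} else {})"
    by (auto simp: le_Suc_eq)
  then show ?thesis by simp
qed

text \<open>The rank rises by 0 or 1 with each added element, so the number of jumps along the
  prefixes is the final rank. Hence the sign in the duality is the same for all \<sigma>.\<close>

lemma card_greedy_basis:
  assumes "is_matroid {1..n} \<I>" "\<sigma> permutes {1..n}"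
  shows "card (greedy_basis n \<I> \<sigma>) = matroid_rank \<I> {1..n}"
proof -
  let ?r = "\<lambda>i. matroid_rank \<I> (\<sigma> ` {1..i})"
  have "card {i \<in> {1..k}. ?r (i - 1) < ?r i} = ?r k" for k
  proof (induction k)
    case 0
    show ?case using matroid_rank_empty[OF assms(1)] by simp
  next
    case (Suc k)
    have split: "card {i \<in> {1..Suc k}. ?r (i - 1) < ?r i} =
        card {i \<in> {1..k}. ?r (i - 1) < ?r i} + (if ?r k < ?r (Suc k) then 1 else 0)"
      using card_filter_Suc[of k "\<lambda>i. ?r (i - 1) < ?r i"] by simp
    have "?r k \<le> ?r (Suc k)" by (rule matroid_rank_mono[OF assms(1)]) auto
    moreover have "?r (Suc k) \<le> Suc (?r k)"
      unfolding image_atLeast1_Suc by (rule matroid_rank_insert_le[OF assms(1)])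
    ultimately show ?case unfolding split Suc by simp
  qed
  from this[of n] have "card {i \<in> {1..n}. ?r (i - 1) < ?r i} = matroid_rank \<I> {1..n}"
    by (simp only: permutes_image[OF assms(2)])
  moreover have "greedy_basis n \<I> \<sigma> = \<sigma> ` {i \<in> {1..n}. ?r (i - 1) < ?r i}"
    unfolding greedy_basis_def by blast
  moreover have "inj_on \<sigma> {i \<in> {1..n}. ?r (i - 1) < ?r i}"
    by (rule inj_on_subset[OF permutes_inj[OF assms(2)] subset_UNIV])
  ultimately show ?thesis by (simp only: card_image)
qed

text \<open>Converts a swap of two values, which a substitution of variables can absorb, into a swap
  of two positions, by which the walls of the fan are indexed.\<close>

lemma transpose_comp_permutation:
  assumes "\<sigma> permutes A"
  shows "transpose (\<sigma> i) (\<sigma> j) \<circ> \<sigma> = \<sigma> \<circ> transpose i j"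
  by (simp add: fun_eq_iff transpose_def inj_eq[OF permutes_inj[OF assms]])

text \<open>Only the prefix of length \<open>i\<close> separates the two positions, so it is the
  only one whose rank can change.\<close>

lemma image_transpose_Suc:
  fixes \<sigma> :: "nat \<Rightarrow> 'a"
  assumes "k \<noteq> i" "1 \<le> i"
  shows "(\<sigma> \<circ> transpose i (Suc i)) ` {1..k} = \<sigma> ` {1..k}"
proof -
  have "transpose i (Suc i) permutes {1..k}" if "i < k"
    using assms(2) that by (intro permutes_swap_id) auto
  then have "transpose i (Suc i) ` {1..k} = {1..k}" if "i < k"
    using that permutes_image by blast
  moreover have "transpose i (Suc i) ` {1..k} = {1..k}" if "k < i"
    using that by (force simp: transpose_def image_iff)
  ultimately have "transpose i (Suc i) ` {1..k} = {1..k}"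
    using assms(1) by linarith
  then show ?thesis by (simp only: image_comp[symmetric])
qed

text \<open>Let S be the prefix before position i, a = \<sigma>(i) and b = \<sigma>(i+1). Both
  orders lead from the rank of S to that of S with a and b, through S with a or S with b. If these
  two middle ranks agree, a and b exchange roles. If they differ, exactly one of a, b raises the
  rank of S, and both orders select that one.\<close>

lemma greedy_basis_adjacent_transposition:
  assumes "is_matroid {1..n} \<I>" "\<sigma> permutes {1..n}" "i \<in> {1..n-1}"
  defines "\<tau> \<equiv> transpose (\<sigma> i) (\<sigma> (Suc i))"
  shows "greedy_basis n \<I> (\<sigma> \<circ> transpose i (Suc i)) \<in>
    {greedy_basis n \<I> \<sigma>, \<tau> ` greedy_basis n \<I> \<sigma>}"
proof -
  define \<sigma>' where "\<sigma>' = \<sigma> \<circ> transpose i (Suc i)"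
  let ?r = "matroid_rank \<I>"
  define S where "S = \<sigma> ` {1..i-1}"
  have i: "1 \<le> i" "i < n" using assms(3) by auto
  have perm: "\<sigma>' permutes {1..n}"
    unfolding \<sigma>'_def using i by (intro permutes_compose assms(2) permutes_swap_id) auto
  have inj: "inj \<sigma>" using assms(2) by (rule permutes_inj)
  have ab: "\<sigma> i \<noteq> \<sigma> (Suc i)" by (simp add: inj_eq[OF inj])
  have img: "\<sigma>' ` {1..k} = \<sigma> ` {1..k}" if "k \<noteq> i" for k
    unfolding \<sigma>'_def using that i(1) by (rule image_transpose_Suc)
  have i_img: "\<rho> ` {1..i} = insert (\<rho> i) (\<rho> ` {1..i-1})" for \<rho> :: "nat \<Rightarrow> nat"
    using image_atLeast1_Suc[of \<rho> "i - 1"] i by simp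
  have \<sigma>'_at: "\<sigma>' i = \<sigma> (Suc i)" "\<sigma>' (Suc i) = \<sigma> i" by (simp_all add: \<sigma>'_def)
  have S': "\<sigma>' ` {1..i-1} = S" using img[of "i - 1"] i by (simp add: S_def)
  have top: "\<sigma>' ` {1..Suc i} = insert (\<sigma> (Suc i)) (insert (\<sigma> i) S)"
    "\<sigma> ` {1..Suc i} = insert (\<sigma> (Suc i)) (insert (\<sigma> i) S)"
    using img[of "Suc i"] image_atLeast1_Suc[of \<sigma> i] i_img[of \<sigma>] by (simp_all add: S_def)
  have a: "\<sigma> i \<in> greedy_basis n \<I> \<sigma> \<longleftrightarrow> ?r S < ?r (insert (\<sigma> i) S)"
    using greedy_basis_mem_iff[OF assms(2), of i] i i_img[of \<sigma>] by (simp add: S_def)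
  have b: "\<sigma> (Suc i) \<in> greedy_basis n \<I> \<sigma> \<longleftrightarrow>
      ?r (insert (\<sigma> i) S) < ?r (insert (\<sigma> (Suc i)) (insert (\<sigma> i) S))"
    using greedy_basis_mem_iff[OF assms(2), of "Suc i"] i i_img[of \<sigma>] top by (simp add: S_def)
  have b': "\<sigma> (Suc i) \<in> greedy_basis n \<I> \<sigma>' \<longleftrightarrow> ?r S < ?r (insert (\<sigma> (Suc i)) S)"
    using greedy_basis_mem_iff[OF perm, of i] i i_img[of \<sigma>'] S' by (simp add: \<sigma>'_at)
  have a': "\<sigma> i \<in> greedy_basis n \<I> \<sigma>' \<longleftrightarrow>
      ?r (insert (\<sigma> (Suc i)) S) < ?r (insert (\<sigma> (Suc i)) (insert (\<sigma> i) S))"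
    using greedy_basis_mem_iff[OF perm, of "Suc i"] i i_img[of \<sigma>'] top S' by (simp add: \<sigma>'_at)
  have other: "\<sigma> j \<in> greedy_basis n \<I> \<sigma>' \<longleftrightarrow> \<sigma> j \<in> greedy_basis n \<I> \<sigma>"
    if "j \<in> {1..n}" "j \<noteq> i" "j \<noteq> Suc i" for j
  proof -
    have "\<sigma>' j = \<sigma> j" using that by (simp add: \<sigma>'_def)
    moreover have "j - 1 \<noteq> i" using that by auto
    ultimately show ?thesis
      using greedy_basis_mem_iff[OF perm that(1)] greedy_basis_mem_iff[OF assms(2) that(1)]
        img[of j] img[of "j - 1"] that(2) by simp
  qed
  have outer: "x \<in> greedy_basis n \<I> \<sigma>' \<longleftrightarrow> x \<in> greedy_basis n \<I> \<sigma>"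
    if "x \<noteq> \<sigma> i" "x \<noteq> \<sigma> (Suc i)" for x
  proof (cases "x \<in> {1..n}")
    case True
    then obtain j where "j \<in> {1..n}" "x = \<sigma> j" using permutes_image[OF assms(2)] by blast
    then show ?thesis using other[of j] that by auto
  next
    case False
    then show ?thesis using greedy_basis_subset[OF perm] greedy_basis_subset[OF assms(2)] by blast
  qed
  have rank_bounds: "?r S \<le> ?r (insert e S)" "?r (insert e S) \<le> Suc (?r S)" for e S
    by (auto intro: matroid_rank_mono[OF assms(1)] matroid_rank_insert_le[OF assms(1)])
  \<comment> \<open>Every added element raises the rank by 0 or 1. The \<open>insert_commute\<close>
    rewriting gives both orders the same final set, so that the unequal case becomes linear
    arithmetic.\<close>
  note bounds = rank_bounds[where S = S and e = "\<sigma> i"] rank_bounds[where S = S and e = "\<sigma> (Suc i)"]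
    rank_bounds[where S = "insert (\<sigma> i) S" and e = "\<sigma> (Suc i)"]
    rank_bounds[where S = "insert (\<sigma> (Suc i)) S" and e = "\<sigma> i",
      unfolded insert_commute[of "\<sigma> i"]]
  show ?thesis
  proof (cases "?r (insert (\<sigma> i) S) = ?r (insert (\<sigma> (Suc i)) S)")
    case True
    have "x \<in> greedy_basis n \<I> \<sigma>' \<longleftrightarrow> \<tau> x \<in> greedy_basis n \<I> \<sigma>" for x
      using True outer[of x] a b a' b' ab unfolding \<tau>_def
      by (cases "x = \<sigma> i"; cases "x = \<sigma> (Suc i)") simp_all
    then have "greedy_basis n \<I> \<sigma>' = \<tau> ` greedy_basis n \<I> \<sigma>"
      unfolding \<tau>_def by (simp add: set_eq_iff in_transpose_image_iff)
    then show ?thesis by (simp add: \<sigma>'_def)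
  next
    case False
    then have "\<sigma> i \<in> greedy_basis n \<I> \<sigma>' \<longleftrightarrow> \<sigma> i \<in> greedy_basis n \<I> \<sigma>"
      "\<sigma> (Suc i) \<in> greedy_basis n \<I> \<sigma>' \<longleftrightarrow> \<sigma> (Suc i) \<in> greedy_basis n \<I> \<sigma>"
      unfolding a b a' b' using bounds by linarith+
    then have "greedy_basis n \<I> \<sigma>' = greedy_basis n \<I> \<sigma>" using outer by (intro set_eqI) metis
    then show ?thesis by (simp add: \<sigma>'_def)
  qed
qed

section \<open>Integrality of \<open>Q\<close>\<close>

lemma permutes_adjacent_mem:
  assumes "\<sigma> permutes {1..n}" "i \<in> {1..n-1}"
  shows "\<sigma> i \<in> {1..n}" "\<sigma> (Suc i) \<in> {1..n}"
  using assms(2) unfolding permutes_in_image[OF assms(1)] by auto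

lemma permutes_adjacent_transposition:
  assumes "\<sigma> permutes {1..n}" "i \<in> {1..n-1}"
  shows "\<sigma> \<circ> transpose i (Suc i) permutes {1..n}"
  using assms(2) by (intro permutes_compose permutes_swap_id assms(1)) auto

text \<open>The wall conditions restated by \<open>X_diff_dvd_iff\<close> as agreement after
  identifying two variables. In this form they are visibly preserved by products.\<close>

lemma PLaur_iff:
  "f \<in> PLaur n \<longleftrightarrow> (\<forall>\<sigma>. \<sigma> permutes {1..n} \<longrightarrow> f \<sigma> \<in> laurent_polys n \<and>
     (\<forall>i \<in> {1..n-1}. subst_var (\<sigma> i) (\<sigma> (Suc i)) (f (\<sigma> \<circ> transpose i (Suc i))) =
       subst_var (\<sigma> i) (\<sigma> (Suc i)) (f \<sigma>)))"
proof -
  have iff: "(\<exists>q \<in> laurent_polys n. f \<sigma> - f (\<sigma> \<circ> transpose i (Suc i)) = (X (\<sigma> i) - X (\<sigma> (Suc i))) * q) \<longleftrightarrow>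
      subst_var (\<sigma> i) (\<sigma> (Suc i)) (f (\<sigma> \<circ> transpose i (Suc i))) = subst_var (\<sigma> i) (\<sigma> (Suc i)) (f \<sigma>)"
    if L: "\<And>\<sigma>. \<sigma> permutes {1..n} \<Longrightarrow> f \<sigma> \<in> laurent_polys n"
      and \<sigma>: "\<sigma> permutes {1..n}" and i: "i \<in> {1..n-1}" for \<sigma> i
    unfolding X_diff_dvd_iff[OF permutes_adjacent_mem[OF \<sigma> i]
      laurent_polys_diff[OF L[OF \<sigma>] L[OF permutes_adjacent_transposition[OF \<sigma> i]]]]
    by (auto simp: map_exps_diff)
  show ?thesis
  \<comment> \<open>The vanishing test applies once all values lie in the subring; otherwise both
    sides are false.\<close>
  proof (cases "\<forall>\<sigma>. \<sigma> permutes {1..n} \<longrightarrow> f \<sigma> \<in> laurent_polys n")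
    case True
    then show ?thesis unfolding PLaur_def mem_Collect_eq Suc_eq_plus1[symmetric] using iff by simp
  next
    case False
    then show ?thesis unfolding PLaur_def by blast
  qed
qed

lemma PLaur_mult:
  assumes "f \<in> PLaur n" "g \<in> PLaur n"
  shows "(\<lambda>\<sigma>. f \<sigma> * g \<sigma>) \<in> PLaur n"
  using assms unfolding PLaur_iff by (simp add: subst_var_mult laurent_polys_mult)

lemma subst_var_transpose [simp]:
  "subst_var a b (X (transpose a b c)) = subst_var a b (X c)"
  "subst_var a b (Xinv (transpose a b c)) = subst_var a b (Xinv c)"
  by (simp_all add: subst_var_X subst_var_Xinv transpose_def)

text \<open>The factor \<open>p\<close> is left abstract to cover both 1 - x_i and the inverse of
  x_i. If crossing a wall moves the greedy basis by \<tau>, reindexing by \<tau> replaces each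
  \<open>p c\<close> by \<open>p (\<tau> c)\<close>, which agrees with it on the wall.\<close>

lemma PLaur_greedy_prod:
  assumes "is_matroid {1..n} \<I>"
    and "\<And>c. c \<in> {1..n} \<Longrightarrow> p c \<in> laurent_polys n"
    and subst: "\<And>a b c. subst_var a b (p (transpose a b c)) = subst_var a b (p c)"
  shows "(\<lambda>\<sigma>. \<Prod>i \<in> {1..n} - greedy_basis n \<I> \<sigma>. p i) \<in> PLaur n"
  unfolding PLaur_iff
proof (intro allI impI conjI ballI)
  fix \<sigma> assume \<sigma>: "\<sigma> permutes {1..n}"
  show "(\<Prod>i \<in> {1..n} - greedy_basis n \<I> \<sigma>. p i) \<in> laurent_polys n"
    using assms(2) by (intro laurent_polys_prod) auto
  fix i assume i: "i \<in> {1..n-1}"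
  define \<tau> where "\<tau> = transpose (\<sigma> i) (\<sigma> (Suc i))"
  let ?B = "greedy_basis n \<I> \<sigma>"
  consider "greedy_basis n \<I> (\<sigma> \<circ> transpose i (Suc i)) = ?B"
    | "greedy_basis n \<I> (\<sigma> \<circ> transpose i (Suc i)) = \<tau> ` ?B"
    using greedy_basis_adjacent_transposition[OF assms(1) \<sigma> i] by (auto simp: \<tau>_def)
  then show "subst_var (\<sigma> i) (\<sigma> (Suc i))
      (\<Prod>j \<in> {1..n} - greedy_basis n \<I> (\<sigma> \<circ> transpose i (Suc i)). p j) =
    subst_var (\<sigma> i) (\<sigma> (Suc i)) (\<Prod>j \<in> {1..n} - ?B. p j)"
  proof cases
    case 2
    have "\<tau> permutes {1..n}"
      unfolding \<tau>_def by (intro permutes_swap_id permutes_adjacent_mem[OF \<sigma> i])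
    then have "\<tau> ` {1..n} = {1..n}" "inj \<tau>" by (rule permutes_image, rule permutes_inj)
    then have "{1..n} - \<tau> ` ?B = \<tau> ` ({1..n} - ?B)" by (simp add: image_set_diff)
    moreover have "inj_on \<tau> ({1..n} - ?B)" using \<open>inj \<tau>\<close> by (rule inj_on_subset) simp
    ultimately show ?thesis
      by (simp add: 2 prod.reindex subst_var_prod subst[of "\<sigma> i" "\<sigma> (Suc i)", folded \<tau>_def])
  qed simp
qed

lemma PLaur_omega:
  assumes "n \<ge> 1" "is_matroid {1..n} \<I>"
  shows "omega n \<I> \<in> PLaur n"
proof -
  have "(\<lambda>\<sigma>. X (\<sigma> n) * Xinv (\<sigma> 1)) \<in> PLaur n"
    unfolding PLaur_iff
  proof (intro allI impI conjI ballI)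
    fix \<sigma> assume \<sigma>: "\<sigma> permutes {1..n}"
    show "X (\<sigma> n) * Xinv (\<sigma> 1) \<in> laurent_polys n"
      using assms(1) permutes_in_image[OF \<sigma>] by (intro laurent_polys_mult) simp_all
    show "subst_var (\<sigma> i) (\<sigma> (Suc i))
        (X ((\<sigma> \<circ> transpose i (Suc i)) n) * Xinv ((\<sigma> \<circ> transpose i (Suc i)) 1)) =
      subst_var (\<sigma> i) (\<sigma> (Suc i)) (X (\<sigma> n) * Xinv (\<sigma> 1))" for i
      \<comment> \<open>Written as a swap of values, the change is invisible to the substitution,
        wherever \<open>i\<close> lies.\<close>
      unfolding transpose_comp_permutation[OF \<sigma>, symmetric]
      by (simp add: subst_var_mult)
  qed
  moreover have "(\<lambda>\<sigma>. \<Prod>i \<in> {1..n} - greedy_basis n \<I> \<sigma>. Xinv i) \<in> PLaur n"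
    by (rule PLaur_greedy_prod[OF assms(2)]) (simp_all)
  ultimately show ?thesis
    unfolding omega_def[abs_def] by (rule PLaur_mult)
qed

section \<open>Fractions without a pole along x_a = x_b\<close>

lemma to_fract_prod [simp]: "to_fract (\<Prod>i\<in>A. p i) = (\<Prod>i\<in>A. to_fract (p i))"
  by (induction A rule: infinite_finite_induct) simp_all

text \<open>For distinct \<open>a\<close>, \<open>b\<close> this is the localization at the kernel
  of the substitution. The fraction need not be reduced: one admissible representation is
  enough.\<close>

definition regular_along :: "nat \<Rightarrow> nat \<Rightarrow> laurent fract set" where
  "regular_along a b = {to_fract p / to_fract q | p q. subst_var a b q \<noteq> 0}"

lemma regular_alongI: "subst_var a b q \<noteq> 0 \<Longrightarrow> to_fract p / to_fract q \<in> regular_along a b"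
  by (auto simp: regular_along_def)

lemma regular_along_add:
  assumes "x \<in> regular_along a b" "y \<in> regular_along a b"
  shows "x + y \<in> regular_along a b"
proof -
  obtain p q p' q' where *: "x = to_fract p / to_fract q" "subst_var a b q \<noteq> 0"
    "y = to_fract p' / to_fract q'" "subst_var a b q' \<noteq> 0"
    using assms by (auto simp: regular_along_def)
  then have "q \<noteq> 0" "q' \<noteq> 0" by auto
  then have "x + y = to_fract (p * q' + p' * q) / to_fract (q * q')"
    by (simp add: * add_frac_eq)
  then show ?thesis using * by (simp only:) (rule regular_alongI, simp add: subst_var_mult)
qed

lemma regular_along_mult:
  assumes "x \<in> regular_along a b" "y \<in> regular_along a b"
  shows "x * y \<in> regular_along a b"
proof -
  obtain p q p' q' where *: "x = to_fract p / to_fract q" "subst_var a b q \<noteq> 0"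
    "y = to_fract p' / to_fract q'" "subst_var a b q' \<noteq> 0"
    using assms by (auto simp: regular_along_def)
  then have "x * y = to_fract (p * p') / to_fract (q * q')" by simp
  then show ?thesis using * by (simp only:) (rule regular_alongI, simp add: subst_var_mult)
qed

lemma regular_along_to_fract [simp]: "to_fract p \<in> regular_along a b"
  using regular_alongI[of a b 1 p] by simp

lemma regular_along_sum:
  "(\<And>i. i \<in> A \<Longrightarrow> x i \<in> regular_along a b) \<Longrightarrow> (\<Sum>i\<in>A. x i) \<in> regular_along a b"
  by (induction A rule: infinite_finite_induct)
    (auto intro: regular_along_add simp: regular_along_to_fract[of 0, unfolded to_fract_0])

text \<open>With x = p/q and x (x_a - x_b) = N, cross-multiplying and substituting shows that N
  times q vanishes on x_a = x_b. Since q does not, N does, so x_a - x_b divides N.\<close>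

lemma laurent_poly_if_regular_along:
  assumes "a \<in> {1..n}" "b \<in> {1..n}" "a \<noteq> b" "x \<in> regular_along a b"
    and "x * to_fract (X a - X b) \<in> to_fract ` laurent_polys n"
  shows "x \<in> to_fract ` laurent_polys n"
proof -
  obtain p q where x: "x = to_fract p / to_fract q" "subst_var a b q \<noteq> 0"
    using assms(4) by (auto simp: regular_along_def)
  obtain N where N: "N \<in> laurent_polys n" "x * to_fract (X a - X b) = to_fract N"
    using assms(5) by blast
  have "q \<noteq> 0" using x(2) by auto
  then have "to_fract (p * (X a - X b)) = to_fract (N * q)"
    using N(2) unfolding x(1) to_fract_mult by (simp add: divide_eq_eq del: to_fract_diff)
  then have "p * (X a - X b) = N * q" unfolding to_fract_eq_iff .
  then have "subst_var a b (p * (X a - X b)) = subst_var a b (N * q)" by simp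
  then have "subst_var a b N = 0" using x(2) by (simp add: subst_var_mult map_exps_diff subst_var_X)
  then obtain N' where "N' \<in> laurent_polys n" "N = (X a - X b) * N'"
    using X_diff_dvd_iff[OF assms(1,2) N(1)] by blast
  moreover have "to_fract (X a - X b) \<noteq> 0" using assms(3) by simp
  ultimately show ?thesis using N(2) by (auto simp del: to_fract_diff)
qed

text \<open>Strips the factors of the common denominator one at a time: multiplying \<open>x\<close>
  by the remaining factors preserves regularity.\<close>

lemma laurent_poly_if_regular:
  assumes "finite P" "\<And>a b. (a, b) \<in> P \<Longrightarrow> a \<in> {1..n} \<and> b \<in> {1..n} \<and> a \<noteq> b \<and> x \<in> regular_along a b"
    and "x * to_fract (\<Prod>(a, b)\<in>P. X a - X b) \<in> to_fract ` laurent_polys n"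
  shows "x \<in> to_fract ` laurent_polys n"
  using assms
proof (induction P rule: finite_induct)
  case empty
  then show ?case by simp
next
  case (insert ab P)
  obtain a b where ab: "ab = (a, b)" by (cases ab)
  let ?y = "x * to_fract (\<Prod>(a, b)\<in>P. X a - X b)"
  have "?y * to_fract (X a - X b) \<in> to_fract ` laurent_polys n"
    using insert.prems(2) insert.hyps by (simp add: ab mult_ac del: to_fract_diff to_fract_prod)
  moreover have "?y \<in> regular_along a b"
    using insert.prems(1)[of a b] by (intro regular_along_mult) (simp_all add: ab del: to_fract_prod)
  ultimately have "?y \<in> to_fract ` laurent_polys n"
    using insert.prems(1)[of a b] laurent_poly_if_regular_along[of a n b] by (simp add: ab del: to_fract_diff to_fract_prod)
  with insert.IH insert.prems(1) show ?case by blast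
qed

section \<open>Sums over the cones of the braid fan\<close>

definition cone_num :: "nat \<Rightarrow> (nat \<Rightarrow> nat) \<Rightarrow> laurent" where
  "cone_num n \<sigma> = (\<Prod>i = 1..n-1. X (\<sigma> i))"

definition cone_den :: "nat \<Rightarrow> (nat \<Rightarrow> nat) \<Rightarrow> laurent" where
  "cone_den n \<sigma> = (\<Prod>i = 1..n-1. X (\<sigma> i) - X (\<sigma> (Suc i)))"

lemma cone_den_nonzero: "\<sigma> permutes {1..n} \<Longrightarrow> cone_den n \<sigma> \<noteq> 0"
  by (simp add: cone_den_def inj_eq[OF permutes_inj])

text \<open>Each factor is cleared of its inner denominator x_\<sigma>(i).\<close>

lemma Q_cone_eq: "Q_cone n \<sigma> = to_fract (cone_num n \<sigma>) / to_fract (cone_den n \<sigma>)"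
proof -
  have "1 - to_fract (X (\<sigma> (i + 1))) / to_fract (X (\<sigma> i)) =
      to_fract (X (\<sigma> i) - X (\<sigma> (Suc i))) / to_fract (X (\<sigma> i))" for i
    by (simp add: diff_divide_distrib)
  then show ?thesis
    unfolding Q_cone_def cone_num_def cone_den_def
    by (simp add: prod_dividef del: to_fract_diff)
qed

text \<open>The matroid factor is absorbed into \<open>g\<close>, so that integrality can be proved
  for every element of \<open>PLaur n\<close>.\<close>

definition cone_sum :: "nat \<Rightarrow> ((nat \<Rightarrow> nat) \<Rightarrow> laurent) \<Rightarrow> laurent fract" where
  "cone_sum n g = (\<Sum>\<sigma> | \<sigma> permutes {1..n}. to_fract (g \<sigma> * cone_num n \<sigma>) / to_fract (cone_den n \<sigma>))"

lemma Q_frac_eq_cone_sum: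
  "Q_frac n \<I> f = cone_sum n (\<lambda>\<sigma>. f \<sigma> * (\<Prod>i \<in> {1..n} - greedy_basis n \<I> \<sigma>. 1 - X i))"
  unfolding Q_frac_def cone_sum_def by (simp add: Q_cone_eq mult_ac)

text \<open>Both denominators contain x_a - x_b once up to sign; let V be the remaining factors and
  u the numerators. The combined numerator u(\<sigma>) V(\<sigma>') - u(\<sigma>') V(\<sigma>)
  vanishes on x_a = x_b, where u and V do not distinguish \<sigma> from \<sigma>', and this cancels
  the pole.\<close>

lemma cone_pair_regular:
  assumes "g \<in> PLaur n" and \<sigma>: "\<sigma> permutes {1..n}" and i: "i \<in> {1..n-1}"
    and ab: "a = \<sigma> i" "b = \<sigma> (Suc i)"
  shows "to_fract (g \<sigma> * cone_num n \<sigma>) / to_fract (cone_den n \<sigma>)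
    + to_fract (g (transpose a b \<circ> \<sigma>) * cone_num n (transpose a b \<circ> \<sigma>)) / to_fract (cone_den n (transpose a b \<circ> \<sigma>))
    \<in> regular_along a b"
proof -
  define \<sigma>' where "\<sigma>' = transpose a b \<circ> \<sigma>"
  have \<sigma>'_eq: "\<sigma>' = \<sigma> \<circ> transpose i (Suc i)"
    unfolding \<sigma>'_def ab by (rule transpose_comp_permutation[OF \<sigma>])
  have \<sigma>': "\<sigma>' permutes {1..n}"
    unfolding \<sigma>'_eq by (rule permutes_adjacent_transposition[OF \<sigma> i])
  define V where "V = (\<lambda>\<rho>. \<Prod>j \<in> {1..n-1} - {i}. X (\<rho> j) - X (\<rho> (Suc j)))"
  have den: "cone_den n \<rho> = (X (\<rho> i) - X (\<rho> (Suc i))) * V \<rho>" for \<rho>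
    unfolding cone_den_def V_def using i by (subst prod.remove[of _ i]) auto
  define u where "u = (\<lambda>\<rho>. g \<rho> * cone_num n \<rho>)"
  have X': "subst_var a b (X (\<sigma>' j)) = subst_var a b (X (\<sigma> j))" for j
    by (simp add: \<sigma>'_def)
  have V_subst: "subst_var a b (V \<sigma>') = subst_var a b (V \<sigma>)"
    by (simp add: V_def subst_var_prod map_exps_diff X')
  have "subst_var a b (g \<sigma>') = subst_var a b (g \<sigma>)"
    using assms(1) \<sigma> i by (simp add: PLaur_iff ab \<sigma>'_eq)
  then have u_subst: "subst_var a b (u \<sigma>') = subst_var a b (u \<sigma>)"
    by (simp add: u_def cone_num_def subst_var_mult subst_var_prod X')
  \<comment> \<open>The values a and b are neighbours only at position i, so no other factor
    collapses.\<close>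
  have V_nz: "subst_var a b (V \<sigma>) \<noteq> 0"
  proof -
    have "subst_var a b (X (\<sigma> j) - X (\<sigma> (Suc j))) \<noteq> 0" if "j \<noteq> i" for j
    proof -
      have "\<sigma> j \<noteq> a" "\<not> (\<sigma> (Suc j) = a \<and> \<sigma> j = b)" "\<sigma> j \<noteq> \<sigma> (Suc j)"
        using that by (simp_all add: ab inj_eq[OF permutes_inj[OF \<sigma>]])
      then show ?thesis by (auto simp: map_exps_diff subst_var_X)
    qed
    then show ?thesis by (simp add: V_def subst_var_prod)
  qed
  have num: "cone_num n \<rho> \<in> laurent_polys n" and V: "V \<rho> \<in> laurent_polys n"
    if "\<rho> permutes {1..n}" for \<rho>
    unfolding cone_num_def V_def using permutes_adjacent_mem[OF that]
    by (auto intro!: laurent_polys_prod laurent_polys_diff laurent_polys_X simp del: atLeastAtMost_iff)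
  have "u \<sigma> * V \<sigma>' - u \<sigma>' * V \<sigma> \<in> laurent_polys n"
    using assms(1) \<sigma> \<sigma>' num V unfolding u_def PLaur_iff
    by (intro laurent_polys_diff laurent_polys_mult) simp_all
  moreover have "a \<in> {1..n}" "b \<in> {1..n}"
    unfolding ab by (rule permutes_adjacent_mem[OF \<sigma> i])+
  moreover have "subst_var a b (u \<sigma> * V \<sigma>' - u \<sigma>' * V \<sigma>) = 0"
    by (simp add: map_exps_diff subst_var_mult V_subst u_subst)
  ultimately obtain w where w: "u \<sigma> * V \<sigma>' - u \<sigma>' * V \<sigma> = (X a - X b) * w"
    using X_diff_dvd_iff by blast
  have "a \<noteq> b" by (simp add: ab inj_eq[OF permutes_inj[OF \<sigma>]])
  then have nz: "to_fract (X a - X b) \<noteq> 0" "to_fract (V \<sigma>) \<noteq> 0" "to_fract (V \<sigma>') \<noteq> 0"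
    using V_nz V_subst by (auto simp del: to_fract_diff)
  \<comment> \<open>In \<sigma>' the value b comes just before a; the resulting sign turns the sum
    into a difference.\<close>
  have dens: "cone_den n \<sigma> = (X a - X b) * V \<sigma>" "cone_den n \<sigma>' = - ((X a - X b) * V \<sigma>')"
    unfolding den by (simp_all add: ab \<sigma>'_eq flip: mult_minus_left)
  have "to_fract (u \<sigma>) / to_fract (cone_den n \<sigma>) + to_fract (u \<sigma>') / to_fract (cone_den n \<sigma>') =
      (to_fract (u \<sigma>) * to_fract (V \<sigma>') - to_fract (u \<sigma>') * to_fract (V \<sigma>)) /
        (to_fract (X a - X b) * (to_fract (V \<sigma>) * to_fract (V \<sigma>')))"
    unfolding dens to_fract_uminus to_fract_mult
    using nz by (simp add: field_simps del: to_fract_diff)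
  also have "\<dots> = to_fract w / to_fract (V \<sigma> * V \<sigma>')"
    unfolding to_fract_mult[symmetric] to_fract_diff[symmetric] w
    unfolding to_fract_mult using nz by simp
  finally show ?thesis
    using V_nz V_subst unfolding \<sigma>'_def[symmetric] u_def
    by (simp only:) (rule regular_alongI, simp add: subst_var_mult)
qed

lemma cone_term_regular:
  assumes \<sigma>: "\<sigma> permutes {1..n}"
    and "\<And>i. i \<in> {1..n-1} \<Longrightarrow> {\<sigma> i, \<sigma> (Suc i)} \<noteq> {a, b}"
  shows "to_fract p / to_fract (cone_den n \<sigma>) \<in> regular_along a b"
proof (rule regular_alongI)
  have "subst_var a b (X (\<sigma> i) - X (\<sigma> (Suc i))) \<noteq> 0" if "i \<in> {1..n-1}" for i
    using assms(2)[OF that] inj_eq[OF permutes_inj[OF \<sigma>], of i "Suc i"]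
    by (auto simp: map_exps_diff subst_var_X)
  then show "subst_var a b (cone_den n \<sigma>) \<noteq> 0"
    by (auto simp: cone_den_def subst_var_prod)
qed

lemma cone_sum_regular:
  assumes "g \<in> PLaur n" "a \<in> {1..n}" "b \<in> {1..n}" "a \<noteq> b"
  shows "cone_sum n g \<in> regular_along a b"
proof -
  define t where "t = (\<lambda>\<sigma>. to_fract (g \<sigma> * cone_num n \<sigma>) / to_fract (cone_den n \<sigma>))"
  define \<tau> where "\<tau> = transpose a b"
  have \<tau>: "\<tau> permutes {1..n}" unfolding \<tau>_def using assms by (intro permutes_swap_id) auto
  \<comment> \<open>Doubling the sum avoids choosing a representative of each pair \<open>{\<sigma>, \<tau> \<circ> \<sigma>}\<close>.\<close>
  have "cone_sum n g = (\<Sum>\<sigma> | \<sigma> permutes {1..n}. t (\<tau> \<circ> \<sigma>))"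
    unfolding cone_sum_def t_def by (rule setum_permutations_compose_left[OF \<tau>])
  then have "cone_sum n g + cone_sum n g = (\<Sum>\<sigma> | \<sigma> permutes {1..n}. t \<sigma> + t (\<tau> \<circ> \<sigma>))"
    by (simp add: sum.distrib cone_sum_def t_def)
  also have "\<dots> \<in> regular_along a b"
  proof (rule regular_along_sum)
    fix \<sigma> assume "\<sigma> \<in> {\<sigma>. \<sigma> permutes {1..n}}"
    then have \<sigma>: "\<sigma> permutes {1..n}" by simp
    then have \<tau>\<sigma>: "\<tau> \<circ> \<sigma> permutes {1..n}" using \<tau> by (rule permutes_compose)
    have \<tau>\<tau>: "\<tau> \<circ> (\<tau> \<circ> \<sigma>) = \<sigma>" by (simp add: \<tau>_def comp_assoc[symmetric])
    consider i where "i \<in> {1..n-1}" "a = \<sigma> i" "b = \<sigma> (Suc i)"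
      | i where "i \<in> {1..n-1}" "b = \<sigma> i" "a = \<sigma> (Suc i)"
      | "\<And>i. i \<in> {1..n-1} \<Longrightarrow> {\<sigma> i, \<sigma> (Suc i)} \<noteq> {a, b}"
      by (metis doubleton_eq_iff)
    then show "t \<sigma> + t (\<tau> \<circ> \<sigma>) \<in> regular_along a b"
    proof cases
      case 1
      then show ?thesis
        unfolding t_def \<tau>_def by (intro cone_pair_regular[OF assms(1) \<sigma>])
    next
      case (2 i)
      \<comment> \<open>Here b precedes a in \<sigma>, so the pair is formed starting from \<tau>
        \<circ> \<sigma>, where a precedes b.\<close>
      then have "a = (\<tau> \<circ> \<sigma>) i" "b = (\<tau> \<circ> \<sigma>) (Suc i)" by (simp_all add: \<tau>_def)
      then have "t (\<tau> \<circ> \<sigma>) + t (\<tau> \<circ> (\<tau> \<circ> \<sigma>)) \<in> regular_along a b"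
        unfolding t_def \<tau>_def
        by (rule cone_pair_regular[OF assms(1) \<tau>\<sigma>[unfolded \<tau>_def] 2(1), folded \<tau>_def, unfolded \<tau>_def])
      then show ?thesis unfolding \<tau>\<tau> by (simp add: add.commute)
    next
      case 3
      then have "{(\<tau> \<circ> \<sigma>) i, (\<tau> \<circ> \<sigma>) (Suc i)} \<noteq> {a, b}" if "i \<in> {1..n-1}" for i
        using that by (auto simp: doubleton_eq_iff \<tau>_def transpose_def split: if_splits)
      with 3 show ?thesis
        unfolding t_def by (intro regular_along_add cone_term_regular \<sigma> \<tau>\<sigma>)
    qed
  qed
  \<comment> \<open>The doubling is undone: the constant 2 survives the substitution, so 1/2 is
    regular.\<close>
  finally have "to_fract 1 / to_fract 2 * (cone_sum n g + cone_sum n g) \<in> regular_along a b"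
    by (intro regular_along_mult regular_alongI) (use map_exps_add[of "subst_exp a b" 1 1] in simp_all)
  moreover have "to_fract (2 :: laurent) = 2"
    using to_fract_add[of 1 "1 :: laurent"] by simp
  moreover have "(2 :: laurent fract) \<noteq> 0"
    using to_fract_eq_0_iff[of "2 :: laurent"] calculation(2) by simp
  ultimately show ?thesis by simp
qed

text \<open>Taking all ordered pairs makes each cone denominator literally a subproduct, with no
  signs to track.\<close>

lemma cone_den_dvd:
  assumes \<sigma>: "\<sigma> permutes {1..n}"
  shows "\<exists>q \<in> laurent_polys n.
    (\<Prod>(a, b) \<in> {1..n} \<times> {1..n} - Id. X a - X b) = cone_den n \<sigma> * q"
proof -
  define R where "R = (\<lambda>i. (\<sigma> i, \<sigma> (Suc i))) ` {1..n-1}"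
  have sub: "R \<subseteq> {1..n} \<times> {1..n} - Id"
    using permutes_adjacent_mem[OF \<sigma>]
    by (auto simp: R_def inj_eq[OF permutes_inj[OF \<sigma>]] simp del: atLeastAtMost_iff)
  have "cone_den n \<sigma> = (\<Prod>(a, b) \<in> R. X a - X b)"
    unfolding R_def cone_den_def
    by (subst prod.reindex) (auto simp: inj_on_def inj_eq[OF permutes_inj[OF \<sigma>]])
  then have "(\<Prod>(a, b) \<in> {1..n} \<times> {1..n} - Id. X a - X b) =
      cone_den n \<sigma> * (\<Prod>(a, b) \<in> {1..n} \<times> {1..n} - Id - R. X a - X b)"
    using prod.subset_diff[OF sub, of "\<lambda>(a, b). X a - X b"] by (simp add: mult.commute)
  moreover have "(\<Prod>(a, b) \<in> {1..n} \<times> {1..n} - Id - R. X a - X b) \<in> laurent_polys n"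
    by (intro laurent_polys_prod) (auto intro!: laurent_polys_diff)
  ultimately show ?thesis by blast
qed

text \<open>The product D of all differences clears every denominator at once;
  \<open>cone_sum_regular\<close> then allows its factors to be cancelled again.\<close>

lemma cone_sum_laurent_poly:
  assumes "g \<in> PLaur n"
  shows "cone_sum n g \<in> to_fract ` laurent_polys n"
proof (rule laurent_poly_if_regular)
  define D where "D = (\<Prod>(a, b) \<in> {1..n} \<times> {1..n} - Id. X a - X b)"
  show "finite ({1..n} \<times> {1..n} - Id)" by simp
  show "a \<in> {1..n} \<and> b \<in> {1..n} \<and> a \<noteq> b \<and> cone_sum n g \<in> regular_along a b"
    if "(a, b) \<in> {1..n} \<times> {1..n} - Id" for a b
    using that cone_sum_regular[OF assms] by auto
  have "\<forall>\<sigma>. \<exists>q. \<sigma> permutes {1..n} \<longrightarrow> q \<in> laurent_polys n \<and> D = cone_den n \<sigma> * q"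
    using cone_den_dvd unfolding D_def by blast
  then obtain q where q: "\<And>\<sigma>. \<sigma> permutes {1..n} \<Longrightarrow> q \<sigma> \<in> laurent_polys n"
    "\<And>\<sigma>. \<sigma> permutes {1..n} \<Longrightarrow> D = cone_den n \<sigma> * q \<sigma>"
    unfolding choice_iff by blast
  let ?N = "\<Sum>\<sigma> | \<sigma> permutes {1..n}. g \<sigma> * cone_num n \<sigma> * q \<sigma>"
  have "to_fract (g \<sigma> * cone_num n \<sigma>) / to_fract (cone_den n \<sigma>) * to_fract D =
      to_fract (g \<sigma> * cone_num n \<sigma> * q \<sigma>)" if "\<sigma> permutes {1..n}" for \<sigma>
    unfolding q(2)[OF that] using cone_den_nonzero[OF that] by simp
  then have "cone_sum n g * to_fract D = to_fract ?N"
    by (simp add: cone_sum_def sum_distrib_right del: to_fract_mult)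
  moreover have "cone_num n \<sigma> \<in> laurent_polys n" if "\<sigma> permutes {1..n}" for \<sigma>
    unfolding cone_num_def by (intro laurent_polys_prod laurent_polys_X permutes_adjacent_mem[OF that])
  then have "?N \<in> laurent_polys n"
    using assms q(1) by (intro laurent_polys_sum laurent_polys_mult) (auto simp: PLaur_iff)
  ultimately show "cone_sum n g * to_fract (\<Prod>(a, b) \<in> {1..n} \<times> {1..n} - Id. X a - X b)
      \<in> to_fract ` laurent_polys n"
    unfolding D_def by blast
qed

section \<open>The functional of a matroid as a Laurent polynomial\<close>

lemma Q_frac_laurent_poly:
  assumes "is_matroid {1..n} \<I>" "f \<in> PLaur n"
  shows "Q_frac n \<I> f \<in> to_fract ` laurent_polys n"
proof -
  have "(\<lambda>\<sigma>. \<Prod>i \<in> {1..n} - greedy_basis n \<I> \<sigma>. 1 - X i) \<in> PLaur n"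
    by (rule PLaur_greedy_prod[OF assms(1)])
      (simp_all add: laurent_polys_diff map_exps_diff)
  then show ?thesis
    unfolding Q_frac_eq_cone_sum by (intro cone_sum_laurent_poly PLaur_mult assms(2))
qed

lemma Q_matroid_eqI:
  assumes "q \<in> laurent_polys n" "to_fract q = Q_frac n \<I> f"
  shows "Q_matroid n \<I> f = q"
  unfolding Q_matroid_def assms(2)[symmetric]
  by (rule the_equality) (simp_all add: assms(1))

text \<open>Stands in for extending the involution to fractions. One pair N, D represents the sum
  and, after inversion, the inverted sum; the identity N = q D lies in the ring and can be inverted
  there.\<close>

lemma invert_vars_sum_fract:
  assumes "finite A" "\<And>i. i \<in> A \<Longrightarrow> d i \<noteq> 0"
    and "(\<Sum>i\<in>A. to_fract (p i) / to_fract (d i)) = to_fract q"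
  shows "(\<Sum>i\<in>A. to_fract (invert_vars (p i)) / to_fract (invert_vars (d i))) = to_fract (invert_vars q)"
proof -
  have "\<exists>N D. D \<noteq> 0 \<and> (\<Sum>i\<in>A. to_fract (p i) / to_fract (d i)) = to_fract N / to_fract D \<and>
    (\<Sum>i\<in>A. to_fract (invert_vars (p i)) / to_fract (invert_vars (d i))) =
      to_fract (invert_vars N) / to_fract (invert_vars D)"
    using assms(1,2)
  proof (induction A rule: finite_induct)
    case empty
    show ?case by (intro exI[of _ 0] exI[of _ 1]) simp
  next
    case (insert i A)
    then obtain N D where "D \<noteq> 0" "(\<Sum>i\<in>A. to_fract (p i) / to_fract (d i)) = to_fract N / to_fract D"
      "(\<Sum>i\<in>A. to_fract (invert_vars (p i)) / to_fract (invert_vars (d i))) =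
        to_fract (invert_vars N) / to_fract (invert_vars D)" by auto
    then show ?case
      using insert.hyps insert.prems[of i]
      by (intro exI[of _ "p i * D + N * d i"] exI[of _ "d i * D"])
        (simp add: add_frac_eq invert_vars_add invert_vars_mult)
  qed
  then obtain N D where ND: "D \<noteq> 0" "(\<Sum>i\<in>A. to_fract (p i) / to_fract (d i)) = to_fract N / to_fract D"
    "(\<Sum>i\<in>A. to_fract (invert_vars (p i)) / to_fract (invert_vars (d i))) =
      to_fract (invert_vars N) / to_fract (invert_vars D)" by blast
  then have "to_fract N = to_fract (q * D)" using assms(3) by (simp add: field_simps)
  then have "N = q * D" unfolding to_fract_eq_iff .
  then show ?thesis using ND by (simp add: invert_vars_mult)
qed

section \<open>Duality\<close>

text \<open>Factorwise x_i (1 - 1/x_i) = -(1 - x_i). The product of the x_i is supplied by the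
  inverse of \<omega>.\<close>

lemma invert_vars_greedy_factor:
  "(\<Prod>i\<in>S. X i) * (\<Prod>i\<in>S. 1 - Xinv i) = (- 1) ^ card S * (\<Prod>i\<in>S. 1 - X i)"
proof -
  have "X i * (1 - Xinv i) = - 1 * (1 - X i)" for i
    by (simp add: right_diff_distrib X_Xinv)
  then have "(\<Prod>i\<in>S. X i * (1 - Xinv i)) = (\<Prod>i\<in>S. - 1 * (1 - X i))" by simp
  then show ?thesis by (simp only: prod.distrib prod_constant)
qed

text \<open>Both sides are the product over 1, ..., m+1: the telescoping of the u_i in division-free
  form.\<close>

lemma prod_mult_last_eq_first_mult_prod:
  fixes x :: "nat \<Rightarrow> 'a::comm_monoid_mult"
  shows "(\<Prod>i = 1..m. x i) * x (Suc m) = x 1 * (\<Prod>i = 1..m. x (Suc i))"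
proof (induction m)
  case (Suc m)
  have "(\<Prod>i = 1..Suc m. y i) = (\<Prod>i = 1..m. y i) * y (Suc m)" for y :: "nat \<Rightarrow> 'a"
    by simp
  then show ?case by (simp only: Suc.IH) (simp only: mult.assoc)
qed simp

text \<open>Cross-multiplied form of the rule that inverting Q(C_\<sigma>) and multiplying by
  x_\<sigma>(1) / x_\<sigma>(n), the inverted end factor of \<omega>, gives (-1)^(n-1)
  Q(C_\<sigma>).\<close>

lemma invert_vars_cone:
  assumes "n \<ge> 1"
  shows "X (\<sigma> 1) * Xinv (\<sigma> n) * invert_vars (cone_num n \<sigma>) * cone_den n \<sigma> =
    (- 1) ^ (n - 1) * cone_num n \<sigma> * invert_vars (cone_den n \<sigma>)"
proof -
  define M where "M = (\<Prod>i = 1..n-1. X (\<sigma> (Suc i)))"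
  define M' where "M' = (\<Prod>i = 1..n-1. Xinv (\<sigma> (Suc i)))"
  have MM': "M * M' = 1"
    by (simp add: M_def M'_def X_Xinv flip: prod.distrib)
  have "cone_num n \<sigma> * X (\<sigma> n) = X (\<sigma> 1) * M"
    using prod_mult_last_eq_first_mult_prod[of "\<lambda>i. X (\<sigma> i)" "n - 1"] assms
    by (simp add: cone_num_def M_def)
  then have "(cone_num n \<sigma> * X (\<sigma> n)) * Xinv (\<sigma> n) * M' = (X (\<sigma> 1) * M) * Xinv (\<sigma> n) * M'"
    by simp
  then have "cone_num n \<sigma> * (X (\<sigma> n) * Xinv (\<sigma> n)) * M' = X (\<sigma> 1) * Xinv (\<sigma> n) * (M * M')"
    by (simp add: mult_ac)
  then have ends: "cone_num n \<sigma> * M' = X (\<sigma> 1) * Xinv (\<sigma> n)"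
    by (simp add: X_Xinv MM')
  have "Xinv c - Xinv d = - 1 * (Xinv c * Xinv d * (X c - X d))" for c d
  proof -
    have "Xinv c * Xinv d * (X c - X d) = Xinv d * (X c * Xinv c) - Xinv c * (X d * Xinv d)"
      by (simp add: algebra_simps)
    then show ?thesis by (simp add: X_Xinv)
  qed
  then have "invert_vars (cone_den n \<sigma>) = (\<Prod>i = 1..n-1. - 1 * (Xinv (\<sigma> i) * Xinv (\<sigma> (Suc i)) *
      (X (\<sigma> i) - X (\<sigma> (Suc i)))))"
    by (simp add: cone_den_def invert_vars_prod invert_vars_diff)
  also have "\<dots> = (- 1) ^ (n - 1) * (invert_vars (cone_num n \<sigma>) * M' * cone_den n \<sigma>)"
    by (simp only: prod.distrib prod_constant M'_def cone_num_def cone_den_def invert_vars_prod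
        invert_vars_X) simp
  finally have "cone_num n \<sigma> * invert_vars (cone_den n \<sigma>) =
      (- 1) ^ (n - 1) * ((cone_num n \<sigma> * M') * invert_vars (cone_num n \<sigma>) * cone_den n \<sigma>)"
    by (simp only: mult_ac)
  \<comment> \<open>The sign squares to 1, so multiplying by it moves it to the other side.\<close>
  then have "(- 1) ^ (n - 1) * (cone_num n \<sigma> * invert_vars (cone_den n \<sigma>)) =
      ((- 1) ^ (n - 1) * (- 1) ^ (n - 1)) *
        ((cone_num n \<sigma> * M') * invert_vars (cone_num n \<sigma>) * cone_den n \<sigma>)"
    by (simp only: mult.assoc)
  then show ?thesis
    unfolding ends by (simp add: mult_ac flip: power_mult_distrib)
qed

text \<open>The exponents add up to 2n - 1 - r, which has the parity of the integer r - 1, also for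
  r = 0.\<close>

lemma neg_one_pow_corank:
  assumes "n \<ge> 1" "r \<le> n"
  shows "(- 1) ^ (n - 1) * (- 1) ^ (n - r) = neg_one_pow (int r - 1)"
proof -
  have "even (n - 1 + (n - r)) \<longleftrightarrow> even (int r - 1)"
    using assms by presburger
  then show ?thesis
    unfolding power_add[symmetric] by (simp only: neg_one_pow_def minus_one_power_iff)
qed

text \<open>The cone sign and the greedy sign combine; since S has n - rk(M) elements for every
  \<sigma>, the scalar can be pulled out of the sum.\<close>

lemma invert_vars_Q_frac_term:
  assumes "n \<ge> 1" "is_matroid {1..n} \<I>" "\<sigma> permutes {1..n}"
  defines "S \<equiv> {1..n} - greedy_basis n \<I> \<sigma>"
  shows "to_fract (invert_vars (p * omega n \<I> \<sigma> * (\<Prod>i\<in>S. 1 - X i) * cone_num n \<sigma>)) /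
      to_fract (invert_vars (cone_den n \<sigma>)) =
    to_fract (neg_one_pow (int (matroid_rank \<I> {1..n}) - 1)) *
      (to_fract (invert_vars p * (\<Prod>i\<in>S. 1 - X i) * cone_num n \<sigma>) / to_fract (cone_den n \<sigma>))"
proof -
  let ?r = "matroid_rank \<I> {1..n}"
  have sub: "greedy_basis n \<I> \<sigma> \<subseteq> {1..n}" by (rule greedy_basis_subset[OF assms(3)])
  have r: "?r \<le> n" "card S = n - ?r"
    using card_greedy_basis[OF assms(2,3)] card_mono[OF _ sub] card_Diff_subset[OF _ sub] finite_subset[OF sub]
    by (simp_all add: S_def)
  have "invert_vars (p * omega n \<I> \<sigma> * (\<Prod>i\<in>S. 1 - X i) * cone_num n \<sigma>) * cone_den n \<sigma> =
      invert_vars p * ((\<Prod>i\<in>S. X i) * (\<Prod>i\<in>S. 1 - Xinv i)) *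
        (X (\<sigma> 1) * Xinv (\<sigma> n) * invert_vars (cone_num n \<sigma>) * cone_den n \<sigma>)"
    by (simp add: omega_def invert_vars_mult invert_vars_prod invert_vars_diff S_def mult_ac)
  also have "\<dots> = ((- 1) ^ (n - 1) * (- 1) ^ (n - ?r)) *
      (invert_vars p * (\<Prod>i\<in>S. 1 - X i) * cone_num n \<sigma>) * invert_vars (cone_den n \<sigma>)"
    unfolding invert_vars_greedy_factor invert_vars_cone[OF assms(1)] r(2) by (simp only: mult_ac)
  finally have "to_fract (invert_vars (p * omega n \<I> \<sigma> * (\<Prod>i\<in>S. 1 - X i) * cone_num n \<sigma>)) *
      to_fract (cone_den n \<sigma>) = to_fract (neg_one_pow (int ?r - 1)) *
      to_fract (invert_vars p * (\<Prod>i\<in>S. 1 - X i) * cone_num n \<sigma>) * to_fract (invert_vars (cone_den n \<sigma>))"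
    unfolding neg_one_pow_corank[OF assms(1) r(1)] by (simp only: to_fract_mult[symmetric])
  moreover have "to_fract (cone_den n \<sigma>) \<noteq> 0" "to_fract (invert_vars (cone_den n \<sigma>)) \<noteq> 0"
    using cone_den_nonzero[OF assms(3)] by simp_all
  ultimately show ?thesis
    by (simp only: times_divide_eq_right frac_eq_eq not_False_eq_True)
qed

theorem theorem1p3:
  fixes n :: nat and \<I> :: "nat set set" and f :: "(nat \<Rightarrow> nat) \<Rightarrow> laurent"
  assumes "n \<ge> 1"
    and "is_matroid {1..n} \<I>"
    and "f \<in> PLaur n"
  shows "omega n \<I> \<in> PLaur n \<and>
    Q_matroid n \<I> (\<lambda>\<sigma>. invert_vars (f \<sigma>)) =
      neg_one_pow (int (matroid_rank \<I> {1..n}) - 1) *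
      invert_vars (Q_matroid n \<I> (\<lambda>\<sigma>. f \<sigma> * omega n \<I> \<sigma>))"
proof
  show omega: "omega n \<I> \<in> PLaur n" by (rule PLaur_omega[OF assms(1,2)])
  let ?\<epsilon> = "neg_one_pow (int (matroid_rank \<I> {1..n}) - 1)"
  have \<epsilon>: "?\<epsilon> * ?\<epsilon> = 1" "?\<epsilon> \<in> laurent_polys n"
    by (simp_all add: neg_one_pow_def laurent_polys_uminus)
  obtain q where q: "q \<in> laurent_polys n" "Q_frac n \<I> (\<lambda>\<sigma>. f \<sigma> * omega n \<I> \<sigma>) = to_fract q"
    using Q_frac_laurent_poly[OF assms(2) PLaur_mult[OF assms(3) omega]] by auto
  have den: "cone_den n \<sigma> \<noteq> 0" if "\<sigma> \<in> {\<sigma>. \<sigma> permutes {1..n}}" for \<sigma>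
    using that cone_den_nonzero by blast
  have "to_fract (invert_vars q) = (\<Sum>\<sigma> | \<sigma> permutes {1..n}. to_fract (invert_vars (f \<sigma> * omega n \<I> \<sigma> *
      (\<Prod>i \<in> {1..n} - greedy_basis n \<I> \<sigma>. 1 - X i) * cone_num n \<sigma>)) / to_fract (invert_vars (cone_den n \<sigma>)))"
    by (rule invert_vars_sum_fract[OF finite_permutations[OF finite_atLeastAtMost] den
      q(2)[unfolded Q_frac_eq_cone_sum cone_sum_def], symmetric])
  also have "\<dots> = to_fract ?\<epsilon> * Q_frac n \<I> (\<lambda>\<sigma>. invert_vars (f \<sigma>))"
    unfolding Q_frac_eq_cone_sum cone_sum_def sum_distrib_left
    by (intro sum.cong refl invert_vars_Q_frac_term[OF assms(1,2)]) blast
  finally have "to_fract (?\<epsilon> * invert_vars q) = to_fract (?\<epsilon> * ?\<epsilon>) * Q_frac n \<I> (\<lambda>\<sigma>. invert_vars (f \<sigma>))"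
    by (simp only: to_fract_mult mult.assoc)
  \<comment> \<open>Since the sign squares to 1, it moves to the side of \<open>q\<close>. This
    equation also shows that the sum for the inverted family is a Laurent polynomial, as
    \<open>Q_matroid_eqI\<close> requires.\<close>
  then have "to_fract (?\<epsilon> * invert_vars q) = Q_frac n \<I> (\<lambda>\<sigma>. invert_vars (f \<sigma>))"
    by (simp only: \<epsilon>(1) to_fract_1 mult_1_left)
  then have "Q_matroid n \<I> (\<lambda>\<sigma>. invert_vars (f \<sigma>)) = ?\<epsilon> * invert_vars q"
    using \<epsilon>(2) q(1) by (intro Q_matroid_eqI laurent_polys_mult invert_vars_laurent_polys)
  moreover have "Q_matroid n \<I> (\<lambda>\<sigma>. f \<sigma> * omega n \<I> \<sigma>) = q"
    by (rule Q_matroid_eqI[OF q(1) q(2)[symmetric]])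
  ultimately show "Q_matroid n \<I> (\<lambda>\<sigma>. invert_vars (f \<sigma>)) =
      ?\<epsilon> * invert_vars (Q_matroid n \<I> (\<lambda>\<sigma>. f \<sigma> * omega n \<I> \<sigma>))" by simp
qed

end
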